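(* Let $(X,K,\|\cdot\|)$ be an ordered Banach space whose norm is semimonotone, and let $T\colon[0,\infty)\to\mathcal{L}(X)$ be a disjointness preserving $\mathrm{C}_0$-semigroup with generator $A\colon X\supseteq\mathcal{D}(A)\to X$. Then $A$ is local.
   Context: All vector spaces are real. A cone $K$ in $X$ is a subset with $\lambda x+\mu y\in K$ for all $x,y\in K$, $\lambda,\mu\ge 0$, and $K\cap(-K)=\{0\}$; it induces the partial order $x\le y:\Leftrightarrow y-x\in K$. $K$ is generating if $X=K-K$. An ordered Banach space $(X,K,\|\cdot\|)$ is a Banach space $(X,\|\cdot\|)$ with a closed generating cone $K$. The norm is semimonotone if there is a constant $M\in\mathbb{R}$ such that $0\le x\le y$ implies $\|x\|\le M\|y\|$. For $S\subseteq X$, $S^{\mathrm{u}}=\{x\in X: x\ge s\text{ for all }s\in S\}$ is the set of upper bounds. Elements $x,y\in X$ are disjoint, $x\perp y$, if $\{x+y,-x-y\}^{\mathrm{u}}=\{x-y,-x+y\}^{\mathrm{u}}$. $\mathcal{L}(X)$ denotes the bounded linear operators on $X$. A linear operator $S\colon X\to X$ is disjointness preserving if $x\perp y$ implies $Sx\perp Sy$; a $\mathrm{C}_0$-semigroup $T$ is disjointness preserving if $T(t)$ is disjointness preserving for every $t\in[0,\infty)$. A linear operator $A\colon X\supseteq\mathcal{D}(A)\to X$, defined on a linear subspace $\mathcal{D}(A)$, is local if for every $x\in\mathcal{D}(A)$ and $y\in X$ with $x\perp y$ one has $Ax\perp y$ (disjointness taken in $X$). *)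

theory Defs
  imports "HOL-Analysis.Analysis"
begin

definition order_cone :: "'a::real_vector set \<Rightarrow> bool" where
  "order_cone K \<longleftrightarrow>
     (\<forall>x\<in>K. \<forall>y\<in>K. \<forall>l m :: real. 0 \<le> l \<longrightarrow> 0 \<le> m \<longrightarrow> l *\<^sub>R x + m *\<^sub>R y \<in> K) \<and>
     K \<inter> uminus ` K = {0}"

definition cone_le :: "'a::real_vector set \<Rightarrow> 'a \<Rightarrow> 'a \<Rightarrow> bool" where
  "cone_le K x y \<longleftrightarrow> y - x \<in> K"

definition generating :: "'a::real_vector set \<Rightarrow> bool" where
  "generating K \<longleftrightarrow> UNIV = {x - y | x y. x \<in> K \<and> y \<in> K}"

definition ordered_banach_space :: "'a::banach set \<Rightarrow> bool" where
  "ordered_banach_space K \<longleftrightarrow> order_cone K \<and> closed K \<and> generating K"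

definition semimonotone_norm :: "'a::real_normed_vector set \<Rightarrow> bool" where
  "semimonotone_norm K \<longleftrightarrow>
     (\<exists>M::real. \<forall>x y. cone_le K 0 x \<longrightarrow> cone_le K x y \<longrightarrow> norm x \<le> M * norm y)"

definition upper_bounds :: "'a::real_vector set \<Rightarrow> 'a set \<Rightarrow> 'a set" where
  "upper_bounds K S = {x. \<forall>s\<in>S. cone_le K s x}"

definition disjoint_elements :: "'a::real_vector set \<Rightarrow> 'a \<Rightarrow> 'a \<Rightarrow> bool" where
  "disjoint_elements K x y \<longleftrightarrow>
     upper_bounds K {x + y, - x - y} = upper_bounds K {x - y, - x + y}"

definition disjointness_preserving :: "'a::real_vector set \<Rightarrow> ('a \<Rightarrow> 'a) \<Rightarrow> bool" where
  "disjointness_preserving K S \<longleftrightarrow>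
     (\<forall>x y. disjoint_elements K x y \<longrightarrow> disjoint_elements K (S x) (S y))"

text \<open>
  A semigroup is a function on all of \<^typ>\<open>real\<close>, of which only the values at \<open>t \<ge> 0\<close> matter.
\<close>

definition c0_semigroup :: "(real \<Rightarrow> 'a::banach \<Rightarrow>\<^sub>L 'a) \<Rightarrow> bool" where
  "c0_semigroup T \<longleftrightarrow>
     T 0 = id_blinfun \<and>
     (\<forall>s\<ge>0. \<forall>t\<ge>0. T (s + t) = T s o\<^sub>L T t) \<and>
     (\<forall>x. ((\<lambda>t. T t x) \<longlongrightarrow> x) (at_right 0))"

definition disjointness_preserving_semigroup ::
    "'a::banach set \<Rightarrow> (real \<Rightarrow> 'a \<Rightarrow>\<^sub>L 'a) \<Rightarrow> bool" where
  "disjointness_preserving_semigroup K T \<longleftrightarrow> (\<forall>t\<ge>0. disjointness_preserving K (T t))"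

definition generator_domain :: "(real \<Rightarrow> 'a::banach \<Rightarrow>\<^sub>L 'a) \<Rightarrow> 'a set" where
  "generator_domain T = {x. \<exists>y. ((\<lambda>h. (1 / h) *\<^sub>R (T h x - x)) \<longlongrightarrow> y) (at_right 0)}"

text \<open>Only the values of the generator on \<open>generator_domain T\<close> are meaningful.\<close>

definition generator :: "(real \<Rightarrow> 'a::banach \<Rightarrow>\<^sub>L 'a) \<Rightarrow> 'a \<Rightarrow> 'a" where
  "generator T x = Lim (at_right 0) (\<lambda>h. (1 / h) *\<^sub>R (T h x - x))"

text \<open>
  A partially defined operator is given by its domain \<open>D\<close> and a total function \<open>A\<close>.  Only the
  elements \<open>x\<close> are restricted to \<open>D\<close>; \<open>y\<close> and the disjointness relation range over the whole
  space.  Linearity is not part of the condition; for the generator it holds by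
  \<open>generator_linear\<close> below.
\<close>

definition local_operator :: "'a::real_vector set \<Rightarrow> 'a set \<Rightarrow> ('a \<Rightarrow> 'a) \<Rightarrow> bool" where
  "local_operator K D A \<longleftrightarrow>
     (\<forall>x\<in>D. \<forall>y. disjoint_elements K x y \<longrightarrow> disjoint_elements K (A x) y)"

lemma generator_tendsto:
  fixes T :: "real \<Rightarrow> 'a::banach \<Rightarrow>\<^sub>L 'a"
  assumes "x \<in> generator_domain T"
  shows "((\<lambda>h. (1 / h) *\<^sub>R (T h x - x)) \<longlongrightarrow> generator T x) (at_right 0)"
  using assms tendsto_Lim[OF trivial_limit_at_right_real]
  unfolding generator_domain_def generator_def by blast

lemma generator_eqI:
  fixes T :: "real \<Rightarrow> 'a::banach \<Rightarrow>\<^sub>L 'a"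
  assumes "((\<lambda>h. (1 / h) *\<^sub>R (T h x - x)) \<longlongrightarrow> y) (at_right 0)"
  shows "x \<in> generator_domain T" and "generator T x = y"
  using assms tendsto_Lim[OF trivial_limit_at_right_real assms]
  unfolding generator_domain_def generator_def by blast+

lemma generator_linear:
  fixes T :: "real \<Rightarrow> 'a::banach \<Rightarrow>\<^sub>L 'a"
  shows "subspace (generator_domain T)"
    and "\<lbrakk>x \<in> generator_domain T; y \<in> generator_domain T\<rbrakk>
           \<Longrightarrow> generator T (x + y) = generator T x + generator T y"
    and "x \<in> generator_domain T \<Longrightarrow> generator T (c *\<^sub>R x) = c *\<^sub>R generator T x"
proof -
  have add: "((\<lambda>h. (1 / h) *\<^sub>R (T h (x + y) - (x + y))) \<longlongrightarrow> generator T x + generator T y) (at_right 0)"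
    if "x \<in> generator_domain T" "y \<in> generator_domain T" for x y
    using tendsto_add[OF generator_tendsto[OF that(1)] generator_tendsto[OF that(2)]]
    by (simp add: blinfun.add_right algebra_simps)
  have scale: "((\<lambda>h. (1 / h) *\<^sub>R (T h (c *\<^sub>R x) - c *\<^sub>R x)) \<longlongrightarrow> c *\<^sub>R generator T x) (at_right 0)"
    if "x \<in> generator_domain T" for x c
    using tendsto_scaleR[OF tendsto_const generator_tendsto[OF that], of c]
    by (simp add: blinfun.scaleR_right scaleR_diff_right mult.commute)
  have "0 \<in> generator_domain T"
    by (rule generator_eqI(1)[of _ _ 0]) simp
  then show "subspace (generator_domain T)"
    unfolding subspace_def using generator_eqI(1)[OF add] generator_eqI(1)[OF scale] by blast
  show "\<lbrakk>x \<in> generator_domain T; y \<in> generator_domain T\<rbrakk>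
           \<Longrightarrow> generator T (x + y) = generator T x + generator T y"
    using add generator_eqI(2) by blast
  show "x \<in> generator_domain T \<Longrightarrow> generator T (c *\<^sub>R x) = c *\<^sub>R generator T x"
    using scale generator_eqI(2) by blast
qed

end

theory Submission
  imports Defs
begin

text \<open>
  In a vector lattice the claim is the estimate
  \<open>\<bar>t\<inverse> (T t x - x)\<bar> \<and> \<bar>y\<bar> \<le> \<bar>y - T t y\<bar>\<close>, valid for \<open>x \<perp> y\<close> because \<open>T t x \<perp> T t y\<close>,
  followed by the limit \<open>t \<rightarrow> 0\<close>.  Here neither \<open>\<bar>x\<bar>\<close> nor infima exist, so \<open>w \<ge> \<bar>x\<bar>\<close> is replaced
  by \<open>w \<ge> \<plusminus>x\<close>, and the pointwise argument ``at every point \<open>x\<close> or \<open>y\<close> vanishes'' by a splitting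
  principle: if \<open>x \<perp> y\<close>, then \<open>z \<ge> 0\<close> follows as soon as \<open>z + p \<ge> 0\<close> for all \<open>p \<ge> \<plusminus>x\<close> and
  \<open>z + q \<ge> 0\<close> for all \<open>q \<ge> \<plusminus>y\<close>.  Splitting along \<open>x \<perp> y\<close> and \<open>T t x \<perp> T t y\<close> gives the estimate.
  For the limit, norm-null errors must have norm-null upper bounds, which is the theorem of
  Klee and Ando on closed generating cones, a consequence of Baire's theorem.
\<close>

section \<open>Cone arithmetic and upper bounds of absolute values\<close>

definition abs_bound :: "'a::real_vector set \<Rightarrow> 'a \<Rightarrow> 'a \<Rightarrow> bool" where
  "abs_bound K w x \<longleftrightarrow> w - x \<in> K \<and> w + x \<in> K"

lemma disjoint_elements_iff:
  "disjoint_elements K x y \<longleftrightarrow> (\<forall>w. abs_bound K w (x + y) \<longleftrightarrow> abs_bound K w (x - y))"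
  unfolding disjoint_elements_def upper_bounds_def cone_le_def abs_bound_def set_eq_iff
  by (simp add: algebra_simps)

lemma order_cone_add: "order_cone K \<Longrightarrow> x \<in> K \<Longrightarrow> y \<in> K \<Longrightarrow> x + y \<in> K"
  unfolding order_cone_def by (metis scaleR_one zero_le_one)

lemma order_cone_scaleR:
  assumes "order_cone K" "x \<in> K" "0 \<le> c"
  shows "c *\<^sub>R x \<in> K"
proof -
  have "c *\<^sub>R x + 0 *\<^sub>R x \<in> K"
    using assms unfolding order_cone_def by blast
  then show ?thesis by simp
qed

lemma order_cone_zero: "order_cone K \<Longrightarrow> 0 \<in> K"
  unfolding order_cone_def by blast

lemma order_cone_scaleR_cancel:
  assumes "order_cone K" "c *\<^sub>R x \<in> K" "0 < c"
  shows "x \<in> K"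
  using order_cone_scaleR[OF assms(1,2), of "inverse c"] assms(3) by simp

lemma order_cone_sum:
  assumes "order_cone K" "\<And>i. i \<in> I \<Longrightarrow> f i \<in> K"
  shows "sum f I \<in> K"
  using assms(2)
  by (induction I rule: infinite_finite_induct)
     (auto simp: order_cone_zero[OF assms(1)] intro: order_cone_add[OF assms(1)])

lemma abs_bound_uminus [simp]: "abs_bound K w (- x) \<longleftrightarrow> abs_bound K w x"
  unfolding abs_bound_def by auto

lemma abs_bound_add:
  assumes "order_cone K" "abs_bound K v x" "abs_bound K w y"
  shows "abs_bound K (v + w) (x + y)"
proof -
  have "(v - x) + (w - y) \<in> K" "(v + x) + (w + y) \<in> K"
    using assms order_cone_add unfolding abs_bound_def by blast+
  then show ?thesis
    unfolding abs_bound_def by (simp add: algebra_simps)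
qed

lemma abs_bound_scaleR:
  assumes "order_cone K" "abs_bound K w x" "0 \<le> c"
  shows "abs_bound K (c *\<^sub>R w) (c *\<^sub>R x)"
  using assms order_cone_scaleR[OF assms(1) _ assms(3)]
  unfolding abs_bound_def by (metis scaleR_add_right scaleR_diff_right)

lemma abs_bound_nonneg:
  assumes "order_cone K" "abs_bound K w x"
  shows "w \<in> K"
proof -
  have "(w - x) + (w + x) \<in> K"
    using assms order_cone_add unfolding abs_bound_def by blast
  then have "2 *\<^sub>R w \<in> K" by (simp add: scaleR_2)
  then show ?thesis by (rule order_cone_scaleR_cancel[OF assms(1)]) simp
qed

lemma ex_abs_bound:
  assumes "order_cone K" "generating K"
  obtains w where "abs_bound K w x"
proof -
  obtain a b where ab: "x = a - b" "a \<in> K" "b \<in> K"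
    using assms(2) unfolding generating_def by blast
  have "2 *\<^sub>R a \<in> K" "2 *\<^sub>R b \<in> K"
    using ab order_cone_scaleR[OF assms(1)] by simp_all
  then have "abs_bound K (a + b) x"
    unfolding abs_bound_def ab(1) by (simp add: scaleR_2 algebra_simps)
  then show ?thesis by (rule that)
qed

text \<open>Dividing by \<open>n\<close> makes the contribution of \<open>r\<close> vanish in the
  limit, and \<open>K\<close> is closed.\<close>

lemma order_cone_archimedean:
  fixes K :: "'a::real_normed_vector set"
  assumes "order_cone K" "closed K" "\<And>n::nat. r + of_nat n *\<^sub>R z \<in> K"
  shows "z \<in> K"
proof -
  have "inverse (of_nat (Suc n)) *\<^sub>R r + z \<in> K" for n
    using order_cone_scaleR[OF assms(1) assms(3)[of "Suc n"], of "inverse (of_nat (Suc n))"]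
    by (simp add: scaleR_add_right del: of_nat_Suc)
  moreover have "(\<lambda>n. inverse (of_nat (Suc n)) *\<^sub>R r + z) \<longlonglongrightarrow> 0 *\<^sub>R r + z"
    by (rule tendsto_add[OF tendsto_scaleR[OF LIMSEQ_inverse_real_of_nat tendsto_const] tendsto_const])
  ultimately show ?thesis
    using closed_sequentially[OF assms(2)] by fastforce
qed

section \<open>Disjointness, the splitting principle and the difference quotient\<close>

lemma disjoint_elements_uminus_right:
  "disjoint_elements K x (- y) \<longleftrightarrow> disjoint_elements K x y"
  unfolding disjoint_elements_iff by auto

text \<open>This replaces the lattice identity |x + y| = |x| \<or> |y| for disjoint
  elements.\<close>

lemma disjoint_abs_bound_add:
  assumes "order_cone K" "disjoint_elements K x y" "abs_bound K p x" "abs_bound K p y"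
  shows "abs_bound K p (x + y)"
proof -
  have K: "2 *\<^sub>R (p - x) \<in> K" "2 *\<^sub>R (p + x) \<in> K" "2 *\<^sub>R (p - y) \<in> K" "2 *\<^sub>R (p + y) \<in> K"
    using assms(3,4) order_cone_scaleR[OF assms(1)] unfolding abs_bound_def by simp_all
  \<comment> \<open>The two differences to check are \<open>2 (p - x)\<close> and
    \<open>2 (p - y)\<close>. Once disjointness turns \<open>x - y\<close> into
    \<open>x + y\<close>, one of them becomes \<open>2 (p - (x + y))\<close>.\<close>
  have "abs_bound K (2 *\<^sub>R p - (x + y)) (x - y)"
    using K unfolding abs_bound_def by (simp add: scaleR_2 algebra_simps)
  then have "abs_bound K (2 *\<^sub>R p - (x + y)) (x + y)"
    using assms(2) unfolding disjoint_elements_iff by blast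
  then have "2 *\<^sub>R (p - (x + y)) \<in> K"
    unfolding abs_bound_def by (simp add: scaleR_2 algebra_simps)
  moreover have "abs_bound K (2 *\<^sub>R p + (x + y)) (x - y)"
    using K unfolding abs_bound_def by (simp add: scaleR_2 algebra_simps)
  then have "abs_bound K (2 *\<^sub>R p + (x + y)) (x + y)"
    using assms(2) unfolding disjoint_elements_iff by blast
  then have "2 *\<^sub>R (p + (x + y)) \<in> K"
    unfolding abs_bound_def by (simp add: scaleR_2 algebra_simps)
  ultimately show ?thesis
    unfolding abs_bound_def using order_cone_scaleR_cancel[OF assms(1)] by fastforce
qed

text \<open>
  In lattice terms the hypotheses say \<open>- z \<le> \<bar>x\<bar> \<and> \<bar>y\<bar> = \<bar>x\<bar> + \<bar>y\<bar> - \<bar>x\<bar> \<or> \<bar>y\<bar>\<close>.  Hence adding \<open>z\<close> to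
  an upper bound of \<open>\<bar>x\<bar> + \<bar>y\<bar>\<close> leaves an upper bound of \<open>\<bar>x\<bar> \<or> \<bar>y\<bar>\<close>, which by disjointness bounds
  \<open>\<bar>x\<bar> + \<bar>y\<bar>\<close> again, so that the step can be iterated.
\<close>

lemma disjoint_split:
  fixes K :: "'a::real_normed_vector set"
  assumes K: "order_cone K" "closed K" "generating K"
    and disj: "disjoint_elements K x y"
    and x: "\<And>p. abs_bound K p x \<Longrightarrow> z + p \<in> K"
    and y: "\<And>q. abs_bound K q y \<Longrightarrow> z + q \<in> K"
  shows "z \<in> K"
proof -
  have step: "abs_bound K (r + z) (x + y)" if r: "abs_bound K r (x + y)" for r
  proof -
    have r': "abs_bound K r (x - y)"
      using disj r unfolding disjoint_elements_iff by blast
    \<comment> \<open>\<open>r\<close> lies above all four elements \<plusminus>x \<plusminus> y.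
      The roles then cross: the hypothesis on \<open>x\<close> makes \<open>r + z\<close> a bound of
      \<open>y\<close>, and conversely.\<close>
    have "abs_bound K (r - y) x" "abs_bound K (r + y) x" "abs_bound K (r - x) y" "abs_bound K (r + x) y"
      using r r' unfolding abs_bound_def by (simp_all add: algebra_simps)
    then have "z + (r - y) \<in> K" "z + (r + y) \<in> K" "z + (r - x) \<in> K" "z + (r + x) \<in> K"
      using x y by blast+
    then have "abs_bound K (r + z) x" "abs_bound K (r + z) y"
      unfolding abs_bound_def by (simp_all add: algebra_simps)
    then show ?thesis by (rule disjoint_abs_bound_add[OF K(1) disj])
  qed
  obtain r where r: "abs_bound K r (x + y)"
    using ex_abs_bound[OF K(1,3)] by blast
  have "abs_bound K (r + of_nat n *\<^sub>R z) (x + y)" for n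
  proof (induction n)
    case 0
    then show ?case using r by simp
  next
    case (Suc n)
    from step[OF this] show ?case by (simp add: algebra_simps)
  qed
  from abs_bound_nonneg[OF K(1) this] show ?thesis
    by (rule order_cone_archimedean[OF K(1,2)])
qed

text \<open>Bounds are positive, so both weights may be raised to \<open>c + d\<close>, which is
  then divided out.\<close>

lemma disjoint_split_scaled:
  fixes K :: "'a::real_normed_vector set"
  assumes K: "order_cone K" "closed K" "generating K"
    and disj: "disjoint_elements K x y" and c: "0 < c" "0 < d"
    and x: "\<And>p. abs_bound K p x \<Longrightarrow> z + c *\<^sub>R p \<in> K"
    and y: "\<And>q. abs_bound K q y \<Longrightarrow> z + d *\<^sub>R q \<in> K"
  shows "z \<in> K"
proof -
  have *: "inverse (c + d) *\<^sub>R z + p \<in> K" if "p \<in> K" "z + e *\<^sub>R p \<in> K" "e \<le> c + d" for p e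
  proof -
    have "(z + e *\<^sub>R p) + (c + d - e) *\<^sub>R p \<in> K"
      using that(3) by (intro order_cone_add[OF K(1) that(2)] order_cone_scaleR[OF K(1) that(1)]) simp
    then have "z + (c + d) *\<^sub>R p \<in> K" by (simp add: algebra_simps)
    then have "inverse (c + d) *\<^sub>R (z + (c + d) *\<^sub>R p) \<in> K"
      using c by (intro order_cone_scaleR[OF K(1)]) auto
    then show ?thesis using c by (simp add: scaleR_add_right del: scaleR_add_left)
  qed
  have "inverse (c + d) *\<^sub>R z \<in> K"
  proof (rule disjoint_split[OF K disj])
    show "inverse (c + d) *\<^sub>R z + p \<in> K" if "abs_bound K p x" for p
      using *[OF abs_bound_nonneg[OF K(1) that] x[OF that]] c by simp
    show "inverse (c + d) *\<^sub>R z + q \<in> K" if "abs_bound K q y" for q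
      using *[OF abs_bound_nonneg[OF K(1) that] y[OF that]] c by simp
  qed
  then show ?thesis
    by (rule order_cone_scaleR_cancel[OF K(1)]) (use c in simp)
qed

text \<open>Used with \<open>a = T h x\<close>, \<open>b = T h y\<close> and
  \<open>t = 1 / h\<close>. In the pointwise picture, the elements \<open>t (a - x) + y\<close> and
  \<open>t (a - x) - y\<close> agree where \<open>y\<close> vanishes and are opposite where
  \<open>x\<close> and \<open>a\<close> vanish. Where \<open>x\<close> and \<open>b\<close> vanish
  they differ by \<open>2 y\<close>, which \<open>2 w\<close> absorbs.\<close>

lemma disjoint_difference_quotient_bound:
  fixes K :: "'a::real_normed_vector set"
  assumes K: "order_cone K" "closed K" "generating K"
    and xy: "disjoint_elements K x y" and ab: "disjoint_elements K a b"
    and w: "abs_bound K w (y - b)" and t: "0 < t"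
    and u: "abs_bound K u (t *\<^sub>R (a - x) + y)"
  shows "abs_bound K (u + 2 *\<^sub>R w) (t *\<^sub>R (a - x) - y)"
proof -
  \<comment> \<open>Stated for arbitrary elements, because the other inequality is this one for the
    negatives of all four.\<close>
  have main: "u + 2 *\<^sub>R w - (t *\<^sub>R (a - x) - y) \<in> K"
    if xy: "disjoint_elements K x y" and ab: "disjoint_elements K a b"
      and w: "abs_bound K w (y - b)" and u: "abs_bound K u (t *\<^sub>R (a - x) + y)"
    for x y a b
  proof (rule disjoint_split_scaled[OF K xy, of "2 * t" 2])
    have w0: "2 *\<^sub>R w \<in> K" "2 *\<^sub>R (w + (y - b)) \<in> K"
      using abs_bound_nonneg[OF K(1) w] w order_cone_scaleR[OF K(1)]
      unfolding abs_bound_def by simp_all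
    have u': "u - (t *\<^sub>R (a - x) + y) \<in> K" "u + (t *\<^sub>R (a - x) + y) \<in> K"
      using u unfolding abs_bound_def by auto
    show "u + 2 *\<^sub>R w - (t *\<^sub>R (a - x) - y) + 2 *\<^sub>R q \<in> K" if q: "abs_bound K q y" for q
    proof -
      have "2 *\<^sub>R (q + y) \<in> K"
        using q order_cone_scaleR[OF K(1)] unfolding abs_bound_def by simp
      from order_cone_add[OF K(1) order_cone_add[OF K(1) u'(1) w0(1)] this]
      show ?thesis by (simp add: scaleR_2 algebra_simps)
    qed
    show "u + 2 *\<^sub>R w - (t *\<^sub>R (a - x) - y) + (2 * t) *\<^sub>R p \<in> K" if p: "abs_bound K p x" for p
    \<comment> \<open>The term with \<open>p\<close> stands for being where \<open>x\<close>
      vanishes; only this case needs the second splitting.\<close>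
    proof (rule disjoint_split_scaled[OF K ab, of "2 * t" 2])
      show "u + 2 *\<^sub>R w - (t *\<^sub>R (a - x) - y) + (2 * t) *\<^sub>R p + (2 * t) *\<^sub>R q \<in> K"
        if q: "abs_bound K q a" for q
      proof -
        have "(2 * t) *\<^sub>R (p + x) \<in> K" "(2 * t) *\<^sub>R (q - a) \<in> K"
          using p q t order_cone_scaleR[OF K(1)] unfolding abs_bound_def by simp_all
        from order_cone_add[OF K(1) order_cone_add[OF K(1) u'(2) w0(1)] order_cone_add[OF K(1) this]]
        show ?thesis by (simp add: scaleR_2 algebra_simps flip: mult_2 scaleR_scaleR)
      qed
      show "u + 2 *\<^sub>R w - (t *\<^sub>R (a - x) - y) + (2 * t) *\<^sub>R p + 2 *\<^sub>R q \<in> K"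
        if q: "abs_bound K q b" for q
      proof -
        have "(2 * t) *\<^sub>R p \<in> K" "2 *\<^sub>R (q + b) \<in> K"
          using abs_bound_nonneg[OF K(1) p] q t order_cone_scaleR[OF K(1)]
          unfolding abs_bound_def by simp_all
        from order_cone_add[OF K(1) order_cone_add[OF K(1) u'(1) w0(2)] order_cone_add[OF K(1) this]]
        show ?thesis by (simp add: scaleR_2 algebra_simps)
      qed
    qed (use t in auto)
  qed (use t in auto)
  have "u + 2 *\<^sub>R w - (t *\<^sub>R (- a - - x) - - y) \<in> K"
  proof (rule main)
    show "disjoint_elements K (- x) (- y)" "disjoint_elements K (- a) (- b)"
      using xy ab unfolding disjoint_elements_iff
      by (metis abs_bound_uminus minus_add_distrib minus_diff_minus)+
    show "abs_bound K w (- y - - b)"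
      using w abs_bound_uminus[of K w "y - b"] by (simp add: algebra_simps)
    show "abs_bound K u (t *\<^sub>R (- a - - x) + - y)"
      using u abs_bound_uminus[of K u "t *\<^sub>R (a - x) + y"] by (simp add: algebra_simps)
  qed
  then show ?thesis
    using main[OF xy ab w u] unfolding abs_bound_def by (simp add: algebra_simps)
qed

section \<open>Upper bounds controlled in norm: Baire category and successive approximation\<close>

lemma approximate_abs_bound:
  fixes K :: "'a::banach set"
  assumes K: "order_cone K" "generating K"
  obtains B r where "0 < B" "0 < r"
    "\<And>y d. norm y < r \<Longrightarrow> 0 < d \<Longrightarrow> \<exists>s w. norm (y - s) < d \<and> norm w \<le> B \<and> abs_bound K w s"
proof -
  \<comment> \<open>These sets cover the space because \<open>K\<close> is generating, so by Baire
    some closure has an interior point.\<close>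
  define S where "S n = {x. \<exists>w. norm w \<le> real n \<and> abs_bound K w x}" for n
  have "\<exists>n. interior (closure (S n)) \<noteq> {}"
  proof (rule ccontr)
    assume "\<not> ?thesis"
    then have "euclidean interior_of \<Union>(range (\<lambda>n. closure (S n))) = {}"
      by (intro Baire_category_alt) (auto simp: completely_metrizable_space_euclidean)
    moreover have "x \<in> \<Union>(range (\<lambda>n. closure (S n)))" for x
    proof -
      obtain w where w: "abs_bound K w x" using ex_abs_bound[OF K] by blast
      obtain n where "norm w \<le> real n" using real_arch_simple by blast
      then have "x \<in> S n" unfolding S_def using w by blast
      then show ?thesis using closure_subset by blast
    qed
    then have "\<Union>(range (\<lambda>n. closure (S n))) = UNIV" by blast
    ultimately show False by simp
  qed
  then obtain n a where "a \<in> interior (closure (S n))" by blast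
  then obtain r where r: "0 < r" "ball a r \<subseteq> closure (S n)"
    unfolding mem_interior by blast
  show ?thesis
  \<comment> \<open>\<open>y\<close> is the difference of \<open>a + y\<close> and \<open>a\<close>,
    both approximable from \<open>S n\<close>, and their bounds add up to norm at most
    \<open>2 n\<close>. The extra 1 keeps the constant positive when \<open>n = 0\<close>.\<close>
  proof (rule that[of "2 * real n + 1" r])
    show "\<exists>s w. norm (y - s) < d \<and> norm w \<le> 2 * real n + 1 \<and> abs_bound K w s"
      if y: "norm y < r" and d: "0 < d" for y d
    proof -
      have "a + y \<in> closure (S n)" "a \<in> closure (S n)"
        using r y by (auto simp: subset_iff dist_norm)
      then obtain p q where "p \<in> S n" "q \<in> S n" and pq: "dist p (a + y) < d / 2" "dist q a < d / 2"
        using d half_gt_zero unfolding closure_approachable by meson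
      then obtain v w where v: "norm v \<le> real n" "abs_bound K v p"
        and w: "norm w \<le> real n" "abs_bound K w q"
        unfolding S_def by blast
      have "norm (y - (p - q)) = norm ((q - a) - (p - (a + y)))"
        by (simp add: algebra_simps)
      also have "\<dots> < d"
        using norm_triangle_ineq4[of "q - a" "p - (a + y)"] pq unfolding dist_norm by linarith
      finally have "norm (y - (p - q)) < d" .
      moreover have "abs_bound K (v + w) (p - q)"
        using abs_bound_add[OF K(1) v(2), of w "- q"] w(2) by simp
      moreover have "norm (v + w) \<le> 2 * real n + 1"
        using norm_triangle_ineq[of v w] v(1) w(1) by linarith
      ultimately show ?thesis by blast
    qed
  qed (use r in auto)
qed

text \<open>As in the open mapping theorem, the approximation is repeated on the remainder. The
  bounds form a geometrically dominated series, which converges by completeness, and closedness of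
  \<open>K\<close> preserves the inequalities.\<close>

lemma ex_abs_bound_norm_le:
  fixes K :: "'a::banach set"
  assumes K: "order_cone K" "closed K" "generating K"
  obtains C where "\<And>x. \<exists>w. norm w \<le> C * norm x \<and> abs_bound K w x"
proof -
  obtain B r where B: "0 < B" and r: "0 < r"
    and approx: "\<And>y d. norm y < r \<Longrightarrow> 0 < d \<Longrightarrow>
      \<exists>s w. norm (y - s) < d \<and> norm w \<le> B \<and> abs_bound K w s"
    using approximate_abs_bound[OF K(1,3)] by blast
  have small: "\<exists>w. norm w \<le> 2 * B \<and> abs_bound K w x" if x: "norm x < r" for x
  proof -
    have "\<exists>y'. norm y' < r / 2 ^ Suc k \<and>
        (\<exists>w. norm w \<le> B * (1 / 2) ^ k \<and> abs_bound K w (y - y'))"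
      if y: "norm y < r / 2 ^ k" for y k
    proof -
      have "norm (2 ^ k *\<^sub>R y) < r" using y by (simp add: field_simps)
      then obtain s w where s: "norm (2 ^ k *\<^sub>R y - s) < r / 2" "norm w \<le> B" "abs_bound K w s"
        using approx[of "2 ^ k *\<^sub>R y" "r / 2"] r by auto
      let ?c = "(1 / 2 :: real) ^ k"
      have c: "?c * 2 ^ k = 1" by (simp add: power_one_over)
      have "y - ?c *\<^sub>R s = ?c *\<^sub>R (2 ^ k *\<^sub>R y - s)"
        using c by (simp add: scaleR_diff_right)
      then have "norm (y - ?c *\<^sub>R s) = ?c * norm (2 ^ k *\<^sub>R y - s)" by simp
      also have "\<dots> < ?c * (r / 2)" using s(1) by (intro mult_strict_left_mono) auto
      also have "\<dots> = r / 2 ^ Suc k" by (simp add: power_one_over)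
      finally have "norm (y - ?c *\<^sub>R s) < r / 2 ^ Suc k" .
      moreover have "abs_bound K (?c *\<^sub>R w) (y - (y - ?c *\<^sub>R s))"
        using abs_bound_scaleR[OF K(1) s(3), of ?c] by simp
      moreover have "norm (?c *\<^sub>R w) \<le> B * ?c"
        using s(2) by (simp add: mult.commute mult_left_mono)
      ultimately show ?thesis by blast
    qed
    \<comment> \<open>\<open>y k\<close> is the remainder after \<open>k\<close> corrections, so the
      corrections \<open>y k - y (Suc k)\<close> telescope to \<open>x\<close>.\<close>
    then have "\<exists>y. \<forall>k. (norm (y k) < r / 2 ^ k \<and> (k = 0 \<longrightarrow> y k = x)) \<and>
        (\<exists>w. norm w \<le> B * (1 / 2) ^ k \<and> abs_bound K w (y k - y (Suc k)))"
      using x by (intro dependent_nat_choice) auto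
    then obtain y w where y: "\<And>k. norm (y k) < r / 2 ^ k" "y 0 = x"
      and w: "\<And>k. norm (w k) \<le> B * (1 / 2) ^ k" "\<And>k. abs_bound K (w k) (y k - y (Suc k))"
      by metis
    have "(\<lambda>k. r * (1 / 2) ^ k) \<longlonglongrightarrow> r * 0"
      by (intro tendsto_intros LIMSEQ_power_zero) simp
    then have "(\<lambda>k. r / 2 ^ k) \<longlonglongrightarrow> 0" by (simp add: power_one_over)
    then have "y \<longlonglongrightarrow> 0"
      by (rule Lim_null_comparison[rotated]) (use y(1) in \<open>auto intro!: always_eventually less_imp_le\<close>)
    then have "(\<lambda>n. x - y n) \<longlonglongrightarrow> x - 0" by (intro tendsto_intros)
    then have lim: "(\<lambda>n. \<Sum>k<n. y k - y (Suc k)) \<longlonglongrightarrow> x"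
      by (simp add: sum_lessThan_telescope' y(2))
    have geo: "(\<lambda>k. B * (1 / 2) ^ k) sums (2 * B)"
      using sums_mult[OF geometric_sums[of "1 / 2 :: real"], of B] by (simp add: mult.commute)
    have nsum: "summable (\<lambda>k. norm (w k))"
      using w(1) by (intro summable_comparison_test'[OF sums_summable[OF geo]]) auto
    then have sw: "(\<lambda>n. \<Sum>k<n. w k) \<longlonglongrightarrow> suminf w"
      using summable_LIMSEQ summable_norm_cancel by blast
    have "norm (suminf w) \<le> (\<Sum>k. norm (w k))" by (rule summable_norm[OF nsum])
    also have "\<dots> \<le> 2 * B"
      using suminf_le[OF w(1) nsum sums_summable[OF geo]] sums_unique[OF geo] by simp
    finally have "norm (suminf w) \<le> 2 * B" .
    moreover have "abs_bound K (\<Sum>k<n. w k) (\<Sum>k<n. y k - y (Suc k))" for n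
    proof -
      have "(\<Sum>k<n. w k - (y k - y (Suc k))) \<in> K" "(\<Sum>k<n. w k + (y k - y (Suc k))) \<in> K"
        using w(2) unfolding abs_bound_def by (auto intro: order_cone_sum[OF K(1)])
      then show ?thesis
        unfolding abs_bound_def by (simp only: sum.distrib sum_subtractf)
    qed
    then have "abs_bound K (suminf w) x"
      unfolding abs_bound_def
      using closed_sequentially[OF K(2) _ tendsto_diff[OF sw lim]]
        closed_sequentially[OF K(2) _ tendsto_add[OF sw lim]] by blast
    ultimately show ?thesis by blast
  qed
  show ?thesis
  proof (rule that)
    fix x :: 'a
    show "\<exists>w. norm w \<le> (4 * B / r) * norm x \<and> abs_bound K w x"
    proof (cases "x = 0")
      case True
      then show ?thesis
        using order_cone_zero[OF K(1)] unfolding abs_bound_def by (intro exI[of _ 0]) simp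
    next
      case False
      \<comment> \<open>Scaling to norm \<open>r / 2\<close> stays strictly inside the ball; undoing
        it turns \<open>2 * B\<close> into \<open>(4 * B / r) * norm x\<close>.\<close>
      let ?c = "r / (2 * norm x)"
      have c: "0 < ?c" using False r by simp
      have "norm (?c *\<^sub>R x) < r" using False r by simp
      from small[OF this] obtain w where w: "norm w \<le> 2 * B" "abs_bound K w (?c *\<^sub>R x)" by blast
      have "abs_bound K (inverse ?c *\<^sub>R w) (inverse ?c *\<^sub>R ?c *\<^sub>R x)"
        using c by (intro abs_bound_scaleR[OF K(1) w(2)] less_imp_le[OF positive_imp_inverse_positive])
      moreover have "inverse ?c *\<^sub>R ?c *\<^sub>R x = x" using False r by simp
      moreover have "norm (inverse ?c *\<^sub>R w) \<le> (4 * B / r) * norm x"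
      proof -
        have "norm (inverse ?c *\<^sub>R w) = inverse ?c * norm w" using r by simp
        also have "\<dots> \<le> inverse ?c * (2 * B)" using r w(1) by (intro mult_left_mono) auto
        finally show ?thesis using r by (simp add: field_simps)
      qed
      ultimately show ?thesis by metis
    qed
  qed
qed

section \<open>Passage to the limit in the difference quotient\<close>

lemma generator_abs_bound:
  fixes K :: "'a::banach set" and T :: "real \<Rightarrow> 'a \<Rightarrow>\<^sub>L 'a"
  assumes K: "order_cone K" "closed K" "generating K"
    and T: "c0_semigroup T" "disjointness_preserving_semigroup K T"
    and x: "x \<in> generator_domain T" and xy: "disjoint_elements K x y"
    and u: "abs_bound K u (generator T x + y)"
  shows "abs_bound K u (generator T x - y)"
proof -
  let ?F = "at_right (0::real)" and ?A = "generator T x"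
  define q where "q t = (1 / t) *\<^sub>R (T t x - x)" for t
  obtain C where "\<And>z::'a. \<exists>w. norm w \<le> C * norm z \<and> abs_bound K w z"
    using ex_abs_bound_norm_le[OF K] by blast
  \<comment> \<open>\<open>W z\<close> plays the part of |z|: the linear norm estimate makes bounds
    of null functions null.\<close>
  then obtain W where W: "\<And>z. norm (W z) \<le> C * norm z" "\<And>z. abs_bound K (W z) z" by metis
  have null: "((\<lambda>t. W (f t)) \<longlongrightarrow> 0) ?F" if "(f \<longlongrightarrow> 0) ?F" for f :: "real \<Rightarrow> 'a"
  proof (rule Lim_null_comparison)
    show "\<forall>\<^sub>F t in ?F. norm (W (f t)) \<le> C * norm (f t)" using W(1) by simp
    show "((\<lambda>t. C * norm (f t)) \<longlongrightarrow> 0) ?F"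
      using tendsto_mult[OF tendsto_const tendsto_norm_zero[OF that], of C] by simp
  qed
  have q: "(q \<longlongrightarrow> ?A) ?F" unfolding q_def by (rule generator_tendsto[OF x])
  have "((\<lambda>t. T t y) \<longlongrightarrow> y) ?F" using T(1) unfolding c0_semigroup_def by blast
  from tendsto_diff[OF tendsto_const this, of y]
  have v0: "((\<lambda>t. W (y - T t y)) \<longlongrightarrow> 0) ?F"
    by (intro null) simp
  have w0: "((\<lambda>t. W (q t - ?A)) \<longlongrightarrow> 0) ?F"
    by (intro null) (use q LIM_zero_iff in blast)
  \<comment> \<open>The first error term moves the bound \<open>u\<close> from the generator to its
    quotient \<open>q t\<close>; the second is the price of replacing \<open>+ y\<close> by
    \<open>- y\<close>.\<close>
  define p where "p t = u + W (q t - ?A) + 2 *\<^sub>R W (y - T t y)" for t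
  have p: "(p \<longlongrightarrow> u) ?F"
    unfolding p_def using tendsto_add[OF tendsto_add[OF tendsto_const w0] tendsto_scaleR[OF tendsto_const v0]]
    by simp
  have bound: "abs_bound K (p t) (q t - y)" if "0 < t" for t
  proof -
    have "disjoint_elements K (T t x) (T t y)"
      using T(2) xy that unfolding disjointness_preserving_semigroup_def disjointness_preserving_def
      by simp
    moreover have "abs_bound K (u + W (q t - ?A)) (q t + y)"
      using abs_bound_add[OF K(1) u W(2), of "q t - ?A"] by (simp add: algebra_simps)
    ultimately show ?thesis
      unfolding p_def q_def
      using disjoint_difference_quotient_bound[OF K xy _ W(2)] that by simp
  qed
  have ev: "\<forall>\<^sub>F t in ?F. abs_bound K (p t) (q t - y)"
    using bound eventually_at_right_less[of 0] by (auto elim: eventually_mono)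
  have "u - (?A - y) \<in> K" "u + (?A - y) \<in> K"
    using ev unfolding abs_bound_def
    by (intro Lim_in_closed_set[OF K(2) _ _ tendsto_diff[OF p tendsto_diff[OF q tendsto_const]]]
        Lim_in_closed_set[OF K(2) _ _ tendsto_add[OF p tendsto_diff[OF q tendsto_const]]];
        auto elim: eventually_mono)+
  then show ?thesis unfolding abs_bound_def by blast
qed

theorem theorem5p1:
  fixes K :: "'a::banach set" and T :: "real \<Rightarrow> 'a \<Rightarrow>\<^sub>L 'a"
  assumes "ordered_banach_space K"
    and "semimonotone_norm K"
    and "c0_semigroup T"
    and "disjointness_preserving_semigroup K T"
  shows "local_operator K (generator_domain T) (generator T)"
proof -
  have K: "order_cone K" "closed K" "generating K"
    using assms(1) unfolding ordered_banach_space_def by auto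
  have "disjoint_elements K (generator T x) y"
    if x: "x \<in> generator_domain T" and xy: "disjoint_elements K x y" for x y
    \<comment> \<open>Each inclusion between the sets of bounds is the other one for
      \<open>- y\<close>.\<close>
    using generator_abs_bound[OF K assms(3,4) x xy]
      generator_abs_bound[OF K assms(3,4) x, of "- y"] xy
    unfolding disjoint_elements_iff[of K "generator T x"]
    by (auto simp: disjoint_elements_uminus_right)
  then show ?thesis unfolding local_operator_def by blast
qed

end
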